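(* Let $\Lambda$ denote any one of the three families of Apostol-type polynomials of order $\alpha$: the Apostol-Bernoulli polynomials $\mathcal{B}_k^{(\alpha)}(x;\lambda)$, the Apostol-Euler polynomials $\mathcal{E}_k^{(\alpha)}(x;\lambda)$, or the Apostol-Genocchi polynomials $\mathcal{G}_k^{(\alpha)}(x;\lambda)$, where $\lambda$ is an arbitrary real or complex parameter and $\alpha$ is an order for which the chosen family is defined. Then for all integers $m\ge 0$, $n\ge 0$, all integers $p\geq 0$ and all $x,y$, the following holds. If $0\le p\le m+n$, then $$\sum_{k=0}^{n}\frac{(n+m-k)!}{(p-k)!}\binom{n}{k}y^k\Lambda_{p-k}^{(\alpha)}(x;\lambda)=\sum_{k=0}^{m}(-y)^k\frac{(n+m-k)!}{(p-k)!}\binom{m}{k}\Lambda_{p-k}^{(\alpha)}(x+y;\lambda).$$ If $p\ge m+n+1$, then $$\sum_{k=0}^{n}\frac{(n+m-k)!}{(p-k)!}\binom{n}{k}y^k\Lambda_{p-k}^{(\alpha)}(x;\lambda)=\sum_{k=0}^{m}(-y)^k\frac{(n+m-k)!}{(p-k)!}\binom{m}{k}\Lambda_{p-k}^{(\alpha)}(x+y;\lambda)-(-1)^m\frac{n!\,m!}{p!}\sum_{k=0}^{p-m-n-1}y^{p-k}\binom{p}{k}\binom{p-k-n-1}{m}\Lambda_k^{(\alpha)}(x;\lambda).$$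
   Context: The Apostol-Bernoulli, Apostol-Euler and Apostol-Genocchi polynomials of order $\alpha$ in the variable $x$ (real or complex) are defined by the generating functions (power series expansions in $t$ around $t=0$) $$\left(\frac{t}{\lambda e^t-1}\right)^{\alpha}e^{xt}=\sum_{k=0}^\infty \mathcal{B}_k^{(\alpha)}(x;\lambda)\frac{t^k}{k!},\qquad \left(\frac{2}{\lambda e^t+1}\right)^{\alpha}e^{xt}=\sum_{k=0}^\infty \mathcal{E}_k^{(\alpha)}(x;\lambda)\frac{t^k}{k!},\qquad \left(\frac{2t}{\lambda e^t+1}\right)^{\alpha}e^{xt}=\sum_{k=0}^\infty \mathcal{G}_k^{(\alpha)}(x;\lambda)\frac{t^k}{k!}.$$ Here $1^\alpha:=1$, and the $\alpha$-th power is taken with a fixed branch analytic near $t=0$. The range of parameters is: for $\mathcal{B}$, $\alpha\in\mathbb{C}$ if $\lambda=1$, and $\alpha$ a nonnegative integer if $\lambda\neq 1$; for $\mathcal{E}$, $\alpha\in\mathbb{C}$ and $\lambda\ne -1$; for $\mathcal{G}$, $\alpha\in\mathbb{C}$ if $\lambda=-1$, and $\alpha$ a nonnegative integer if $\lambda\ne -1$. Convention: $\Lambda_k^{(\alpha)}(x;\lambda)=0$ for $k\le -1$, and any term containing such a polynomial (including the accompanying $1/(p-k)!$ with $p-k<0$) is zero. *)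

theory Defs
  imports "HOL-Complex_Analysis.Complex_Analysis"
begin

text \<open>
  \<open>power_branch g \<alpha> f\<close>: the function \<open>f\<close> is a branch of \<open>g\<^sup>\<alpha>\<close> analytic at \<open>0\<close>.
  The function \<open>g\<close> is only considered on a punctured neighbourhood of \<open>0\<close>, because the
  quotients used below may have the form \<open>0 / 0\<close> at \<open>0\<close>. For \<open>\<alpha> \<in> \<nat>\<close> this is the ordinary
  power, also when \<open>g\<close> vanishes at \<open>0\<close>; otherwise it is \<open>exp (\<alpha> * L)\<close> for an arbitrary
  analytic logarithm \<open>L\<close> of \<open>g\<close>. The principal power \<open>powr\<close> would not do: for instance
  \<open>2 * t / (1 - exp t)\<close> tends to \<open>-2\<close>, which lies on its branch cut. The second conjunct is
  the normalization \<open>1\<^sup>\<alpha> = 1\<close>.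
\<close>

definition power_branch ::
    "(complex \<Rightarrow> complex) \<Rightarrow> complex \<Rightarrow> (complex \<Rightarrow> complex) \<Rightarrow> bool" where
  "power_branch g \<alpha> f \<longleftrightarrow>
     f analytic_on {0} \<and>
     ((g \<longlongrightarrow> 1) (at 0) \<longrightarrow> f 0 = 1) \<and>
     ((\<exists>n::nat. \<alpha> = of_nat n \<and> (\<forall>\<^sub>F t in at 0. f t = g t ^ n)) \<or>
      (\<exists>L. L analytic_on {0} \<and> (\<forall>\<^sub>F t in at 0. exp (L t) = g t \<and> f t = exp (\<alpha> * L t))))"

text \<open>
  One branch \<open>f\<close> serves for all \<open>x\<close>; the polynomials are determined by that choice.
\<close>

definition generated_by ::
    "(complex \<Rightarrow> complex) \<Rightarrow> complex \<Rightarrow> (nat \<Rightarrow> complex \<Rightarrow> complex) \<Rightarrow> bool" where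
  "generated_by g \<alpha> P \<longleftrightarrow>
     (\<exists>f. power_branch g \<alpha> f \<and>
        (\<forall>x. (\<lambda>t. f t * exp (x * t)) has_fps_expansion Abs_fps (\<lambda>k. P k x / fact k)))"

definition apostol_bernoulli ::
    "complex \<Rightarrow> complex \<Rightarrow> (nat \<Rightarrow> complex \<Rightarrow> complex) \<Rightarrow> bool" where
  "apostol_bernoulli \<alpha> l B \<longleftrightarrow>
     (l \<noteq> 1 \<longrightarrow> \<alpha> \<in> \<nat>) \<and> generated_by (\<lambda>t. t / (l * exp t - 1)) \<alpha> B"

definition apostol_euler ::
    "complex \<Rightarrow> complex \<Rightarrow> (nat \<Rightarrow> complex \<Rightarrow> complex) \<Rightarrow> bool" where
  "apostol_euler \<alpha> l E \<longleftrightarrow>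
     l \<noteq> -1 \<and> generated_by (\<lambda>t. 2 / (l * exp t + 1)) \<alpha> E"

definition apostol_genocchi ::
    "complex \<Rightarrow> complex \<Rightarrow> (nat \<Rightarrow> complex \<Rightarrow> complex) \<Rightarrow> bool" where
  "apostol_genocchi \<alpha> l G \<longleftrightarrow>
     (l \<noteq> -1 \<longrightarrow> \<alpha> \<in> \<nat>) \<and> generated_by (\<lambda>t. 2 * t / (l * exp t + 1)) \<alpha> G"

text \<open>Each family exists in its whole range of parameters.\<close>

lemma generated_by_exists:
  assumes "power_branch g \<alpha> f"
  shows "\<exists>P. generated_by g \<alpha> P"
proof -
  define F where "F = (\<lambda>x t. f t * exp (x * t))"
  have "F x analytic_on {0}" for x
    using assms unfolding F_def power_branch_def by (auto intro!: analytic_intros)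
  hence *: "F x has_fps_expansion fps_expansion (F x) 0" for x
    using analytic_at_imp_has_fps_expansion_0 by blast
  have "generated_by g \<alpha> (\<lambda>k x. fact k * fps_nth (fps_expansion (F x) 0) k)"
    unfolding generated_by_def using assms *
    by (intro exI[of _ f]) (simp add: F_def fps_nth_inverse)
  thus ?thesis by blast
qed

lemma power_branch_nat:
  assumes "h analytic_on {0}" "\<forall>\<^sub>F t in at 0. h t = g t"
  shows "power_branch g (of_nat n) (\<lambda>t. h t ^ n)"
proof -
  have "h 0 = 1" if "(g \<longlongrightarrow> 1) (at 0)"
  proof -
    have "(h \<longlongrightarrow> 1) (at 0)"
      using that filterlim_cong[OF refl refl assms(2)] by blast
    moreover have "(h \<longlongrightarrow> h 0) (at 0)"
      using analytic_at_imp_isCont[OF assms(1)] by (simp add: isCont_def)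
    ultimately show ?thesis using LIM_unique by blast
  qed
  moreover have "\<forall>\<^sub>F t in at 0. h t ^ n = g t ^ n"
    using assms(2) by eventually_elim simp
  ultimately show ?thesis
    unfolding power_branch_def using assms(1) by (auto intro!: analytic_intros)
qed

lemma power_branch_nonzero:
  assumes "h analytic_on {0}" "\<forall>\<^sub>F t in at 0. h t = g t" "h 0 \<noteq> 0"
  shows "\<exists>f. power_branch g \<alpha> f"
proof -
  define L where "L = (\<lambda>t. Ln (h t / h 0) + Ln (h 0))"
  have L: "L analytic_on {0}"
    unfolding L_def using assms(1,3) by (auto intro!: analytic_intros)
  have hc: "(h \<longlongrightarrow> h 0) (at 0)"
    using analytic_at_imp_isCont[OF assms(1)] by (simp add: isCont_def)
  have "\<forall>\<^sub>F t in at 0. h t \<noteq> 0"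
    using hc assms(3) by (rule tendsto_imp_eventually_ne)
  with assms(2) have "\<forall>\<^sub>F t in at 0. exp (L t) = g t \<and> exp (\<alpha> * L t) = exp (\<alpha> * L t)"
    by eventually_elim (use assms(3) in \<open>auto simp: L_def exp_add\<close>)
  moreover have "exp (\<alpha> * L 0) = 1" if "(g \<longlongrightarrow> 1) (at 0)"
  proof -
    have "(h \<longlongrightarrow> 1) (at 0)"
      using that filterlim_cong[OF refl refl assms(2)] by blast
    with hc have "h 0 = 1" using LIM_unique by blast
    thus ?thesis by (simp add: L_def)
  qed
  ultimately have "power_branch g \<alpha> (\<lambda>t. exp (\<alpha> * L t))"
    unfolding power_branch_def using L by (auto intro!: analytic_intros)
  thus ?thesis by blast
qed

lemma exp_quotient_extends:
  obtains h :: "complex \<Rightarrow> complex"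
  where "h analytic_on {0}" "h 0 = 1" "\<And>t. t \<noteq> 0 \<Longrightarrow> h t = t / (exp t - 1)"
proof
  define e where "e = (\<lambda>t::complex. if t = 0 then 1 else (exp t - 1) / t)"
  have "deriv (\<lambda>t::complex. exp t - 1) 0 = 1"
    by (rule DERIV_imp_deriv) (auto intro!: derivative_eq_intros)
  moreover have "\<exists>d>0. \<forall>w\<in>ball z d - {0}. exp w - 1 = (w - 0) * e w" for z
    by (rule exI[of _ 1]) (simp add: e_def)
  moreover have "(\<lambda>t::complex. exp t - 1) analytic_on {0}"
    by (intro analytic_intros)
  ultimately have "e analytic_on {0}"
    using pole_theorem_analytic_0[of "\<lambda>t. exp t - 1" "{0}" 0 e] by (simp add: e_def)
  thus "(\<lambda>t. 1 / e t) analytic_on {0}"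
    by (intro analytic_intros) (auto simp: e_def)
  show "1 / e 0 = 1" by (simp add: e_def)
  show "1 / e t = t / (exp t - 1)" if "t \<noteq> 0" for t
    using that by (simp add: e_def)
qed

lemma apostol_bernoulli_exists:
  assumes "l \<noteq> 1 \<longrightarrow> \<alpha> \<in> \<nat>"
  shows "\<exists>B. apostol_bernoulli \<alpha> l B"
proof (cases "l = 1")
  case True
  obtain h where h: "h analytic_on {0}" "h 0 = 1"
      "\<And>t::complex. t \<noteq> 0 \<Longrightarrow> h t = t / (exp t - 1)"
    using exp_quotient_extends by metis
  have "\<exists>f. power_branch (\<lambda>t. t / (exp t - 1)) \<alpha> f"
    by (rule power_branch_nonzero[OF h(1)]) (use h in \<open>auto simp: eventually_at_filter\<close>)
  thus ?thesis
    using True generated_by_exists by (auto simp: apostol_bernoulli_def)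
next
  case False
  then obtain n where n: "\<alpha> = of_nat n" using assms by (auto elim: Nats_cases)
  have "(\<lambda>t. t / (l * exp t - 1)) analytic_on {0}"
    using False by (auto intro!: analytic_intros)
  from power_branch_nat[OF this, of _ n]
  have "power_branch (\<lambda>t. t / (l * exp t - 1)) \<alpha> (\<lambda>t. (t / (l * exp t - 1)) ^ n)"
    unfolding n by simp
  from generated_by_exists[OF this] show ?thesis
    using assms by (simp add: apostol_bernoulli_def)
qed

lemma apostol_euler_exists:
  assumes "l \<noteq> -1"
  shows "\<exists>E. apostol_euler \<alpha> l E"
proof -
  have l: "l + 1 \<noteq> 0" using assms by (metis add_eq_0_iff2)
  have "(\<lambda>t. 2 / (l * exp t + 1)) analytic_on {0}"
    using l by (auto intro!: analytic_intros)
  then obtain f where "power_branch (\<lambda>t. 2 / (l * exp t + 1)) \<alpha> f"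
    using power_branch_nonzero[where h = "\<lambda>t. 2 / (l * exp t + 1)"] l by force
  from generated_by_exists[OF this] show ?thesis
    using assms by (simp add: apostol_euler_def)
qed

lemma apostol_genocchi_exists:
  assumes "l \<noteq> -1 \<longrightarrow> \<alpha> \<in> \<nat>"
  shows "\<exists>G. apostol_genocchi \<alpha> l G"
proof (cases "l = -1")
  case True
  obtain h where h: "h analytic_on {0}" "h 0 = 1"
      "\<And>t::complex. t \<noteq> 0 \<Longrightarrow> h t = t / (exp t - 1)"
    using exp_quotient_extends by metis
  have "-2 * h t = 2 * t / (- exp t + 1)" if "t \<noteq> 0" for t
    unfolding h(3)[OF that] using minus_divide_right[of "2 * t" "exp t - 1"] by simp
  hence "\<exists>f. power_branch (\<lambda>t. 2 * t / (- exp t + 1)) \<alpha> f"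
    by (intro power_branch_nonzero[where h = "\<lambda>t. -2 * h t"])
       (use h in \<open>auto simp: eventually_at_filter intro!: analytic_intros\<close>)
  thus ?thesis
    using True generated_by_exists by (auto simp: apostol_genocchi_def)
next
  case False
  then obtain n where n: "\<alpha> = of_nat n" using assms by (auto elim: Nats_cases)
  have "l + 1 \<noteq> 0" using False by (metis add_eq_0_iff2)
  hence "(\<lambda>t. 2 * t / (l * exp t + 1)) analytic_on {0}"
    by (auto intro!: analytic_intros)
  from power_branch_nat[OF this, of _ n]
  have "power_branch (\<lambda>t. 2 * t / (l * exp t + 1)) \<alpha> (\<lambda>t. (2 * t / (l * exp t + 1)) ^ n)"
    unfolding n by simp
  from generated_by_exists[OF this] show ?thesis
    using assms by (simp add: apostol_genocchi_def)
qed

end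

theory Submission
  imports Defs
begin

text \<open>
  Only one property of the three families matters: their generating functions have the form
  \<open>f t * exp (x * t)\<close>, so the normalized values \<open>\<Lambda> k x / k!\<close> satisfy the addition formula
  \<open>\<Lambda> q (x + y) / q! = (\<Sum>s\<le>q. y ^ s / s! * (\<Lambda> (q - s) x / (q - s)!))\<close>
  (\<open>generated_by_add\<close>). Expanding \<open>\<Lambda> (p - k) (x + y)\<close> on the right-hand side of the claim and
  collecting the terms with \<open>\<Lambda> (p - s) x / (p - s)!\<close>, one finds as coefficient \<open>y ^ s\<close> times
  the alternating sum
  \<open>T(m,n,s) = (\<Sum>k\<le>min m s. (-1)^k * (m choose k) * (n+m-k)!/(s-k)!)\<close>.
  Pascal's rule yields \<open>T(m+1,n,s) = T(m,n+1,s) - T(m,n,s-1)\<close>, the last term being absent for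
  \<open>s = 0\<close>, and from this, by induction on \<open>m\<close>,
  \<open>T(m,n,s) = n!/s! * (n+1-s)(n+2-s)\<dots>(n+m-s)\<close> for all \<open>s\<close> (\<open>alt_fact_sum_eq_pochhammer\<close>).

  For \<open>s \<le> m + n\<close> this is \<open>(n+m-s)! * (n choose s)\<close>, which is the coefficient on the left-hand side
  and vanishes for \<open>s > n\<close>. For \<open>s > m + n\<close> all factors of the product are negative and
  \<open>T(m,n,s) = (-1)^m * n! * m!/s! * (s-n-1 choose m)\<close>. Such \<open>s\<close> contribute only if
  \<open>p \<ge> m + n + 1\<close>, and they form the correction term.
\<close>

section \<open>An alternating sum of quotients of factorials\<close>

lemma sum_binomial_Suc:
  fixes F :: "nat \<Rightarrow> 'a::comm_semiring_1"
  shows "(\<Sum>k\<le>Suc m. of_nat (Suc m choose k) * F k) =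
         (\<Sum>k\<le>m. of_nat (m choose k) * F k) + (\<Sum>k\<le>m. of_nat (m choose k) * F (Suc k))"
proof -
  have "(\<Sum>k\<le>m. of_nat (m choose k) * F k) = (\<Sum>k\<le>Suc m. of_nat (m choose k) * F k)"
    by (simp add: binomial_eq_0)
  also have "\<dots> = F 0 + (\<Sum>k\<le>m. of_nat (m choose Suc k) * F (Suc k))"
    by (subst sum.atMost_Suc_shift) simp
  finally show ?thesis
    by (subst sum.atMost_Suc_shift) (simp add: sum.distrib algebra_simps)
qed

text \<open>
  The sum \<open>T(m,n,s)\<close> above. The terms with \<open>k > s\<close>, where \<open>1/(s-k)!\<close> is to be read as \<open>0\<close>, have
  to be removed explicitly, since subtraction of natural numbers truncates.
\<close>

definition alt_fact_sum :: "nat \<Rightarrow> nat \<Rightarrow> nat \<Rightarrow> 'a::field_char_0" where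
  "alt_fact_sum m n s =
     (\<Sum>k\<le>m. of_nat (m choose k) *
        (if k \<le> s then (-1) ^ k * fact (n + m - k) / fact (s - k) else 0))"

lemma alt_fact_sum_Suc:
  "alt_fact_sum (Suc m) n s =
     alt_fact_sum m (Suc n) s - (if s = 0 then 0 else alt_fact_sum m n (s - 1))"
proof (cases s)
  case 0
  then show ?thesis
    unfolding alt_fact_sum_def sum_binomial_Suc by (simp cong: if_cong)
next
  case (Suc r)
  then show ?thesis
    unfolding alt_fact_sum_def sum_binomial_Suc
    by (simp add: sum_negf [symmetric] if_distrib cong: if_cong)
qed

lemma alt_fact_sum_eq_pochhammer:
  "(alt_fact_sum m n s :: 'a::field_char_0) =
     fact n / fact s * pochhammer (of_nat n + 1 - of_nat s) m"
proof (induction m arbitrary: n s)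
  case 0
  then show ?case by (simp add: alt_fact_sum_def)
next
  case (Suc m)
  define P :: 'a where "P = pochhammer (of_nat n + 1 - of_nat s + 1) m"
  have rec: "pochhammer (of_nat n + 1 - of_nat s) (Suc m) = (of_nat n + 1 - of_nat s) * P"
    by (simp add: P_def pochhammer_rec)
  have P1: "alt_fact_sum m (Suc n) s = fact (Suc n) / fact s * P"
    unfolding Suc.IH P_def by (simp add: algebra_simps)
  show ?case
  proof (cases s)
    case 0
    then show ?thesis
      unfolding alt_fact_sum_Suc P1 rec by (simp add: algebra_simps)
  next
    case (Suc r)
    have P2: "alt_fact_sum m n r = fact n / fact r * P"
      unfolding Suc.IH P_def Suc by (simp add: algebra_simps)
    have r: "1 / fact r = (of_nat s :: 'a) / fact s"
      using Suc by (simp add: field_simps del: of_nat_Suc)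
    have "alt_fact_sum (Suc m) n s = fact (Suc n) / fact s * P - fact n * (1 / fact r) * P"
      unfolding alt_fact_sum_Suc P1 using Suc P2 by simp
    also have "\<dots> = fact n / fact s * ((of_nat n + 1 - of_nat s) * P)"
      unfolding r by (simp add: field_simps)
    finally show ?thesis
      unfolding rec .
  qed
qed

lemma alt_fact_sum_eq_binomial:
  assumes "s \<le> m + n"
  shows "(alt_fact_sum m n s :: 'a::field_char_0) = fact (n + m - s) * of_nat (n choose s)"
proof (cases "s \<le> n")
  case True
  define d where "d = n - s"
  have n: "n = s + d"
    using True by (simp add: d_def)
  have "(fact (d + m) :: 'a) = fact d * pochhammer (1 + of_nat d) m"
    by (simp add: pochhammer_fact pochhammer_product')
  then show ?thesis
    unfolding alt_fact_sum_eq_pochhammer n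
    by (simp add: binomial_fact add.commute)
next
  case False
  define d where "d = s - n - 1"
  have s: "s = n + 1 + d" "d < m"
    using False assms by (auto simp: d_def)
  have "pochhammer (- of_nat d :: 'a) m = 0"
    using s(2) by (rule pochhammer_of_nat_eq_0_lemma)
  then show ?thesis
    unfolding alt_fact_sum_eq_pochhammer s(1) by simp
qed

lemma alt_fact_sum_eq_correction:
  assumes "s \<ge> m + n + 1"
  shows "(alt_fact_sum m n s :: 'a::field_char_0) =
           (-1) ^ m * (fact n * fact m / fact s) * of_nat ((s - n - 1) choose m)"
proof -
  define d where "d = s - n - 1"
  have s: "s = n + 1 + d"
    using assms by (auto simp: d_def)
  have "of_nat (d choose m) = (-1) ^ m * pochhammer (- of_nat d :: 'a) m / fact m"
    by (simp add: binomial_gbinomial gbinomial_pochhammer)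
  then have "fact m * of_nat (d choose m) = (-1) ^ m * pochhammer (- of_nat d :: 'a) m"
    by (simp add: field_simps)
  then have "pochhammer (- of_nat d :: 'a) m = (-1) ^ m * (fact m * of_nat (d choose m))"
    by (simp flip: mult.assoc power_mult_distrib)
  then show ?thesis
    unfolding alt_fact_sum_eq_pochhammer d_def [symmetric]
    by (simp add: s)
qed

section \<open>The addition formula\<close>

lemma generated_by_add:
  assumes "generated_by g \<alpha> P"
  shows "P q (x + y) / fact q = (\<Sum>s\<le>q. y ^ s / fact s * (P (q - s) x / fact (q - s)))"
proof -
  obtain f where f: "\<And>x. (\<lambda>t. f t * exp (x * t)) has_fps_expansion Abs_fps (\<lambda>k. P k x / fact k)"
    using assms unfolding generated_by_def by blast
  have "(\<lambda>t. exp (y * t) * (f t * exp (x * t))) has_fps_expansion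
          fps_exp y * Abs_fps (\<lambda>k. P k x / fact k)"
    by (intro has_fps_expansion_mult has_fps_expansion_exp f)
  moreover have "(\<lambda>t. exp (y * t) * (f t * exp (x * t))) = (\<lambda>t. f t * exp ((x + y) * t))"
    by (simp add: fun_eq_iff distrib_right exp_add)
  ultimately have "Abs_fps (\<lambda>k. P k (x + y) / fact k) =
                   fps_exp y * Abs_fps (\<lambda>k. P k x / fact k)"
    using f [of "x + y"] fps_expansion_unique_complex by metis
  from arg_cong [OF this, of "\<lambda>F. fps_nth F q"] show ?thesis
    by (simp add: fps_mult_nth atLeast0AtMost)
qed

text \<open>
  For two sequences related as in the addition formula, the alternating sum of the values \<open>b\<close>
  expands in the values \<open>a\<close> with coefficients \<open>T(m,n,s)\<close>, whatever the size of \<open>p\<close>.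
\<close>

lemma alternating_sum_expand:
  fixes a b :: "nat \<Rightarrow> 'a::field_char_0"
  assumes b: "\<And>q. b q = (\<Sum>s\<le>q. y ^ s / fact s * a (q - s))"
  shows "(\<Sum>k\<le>m. if k \<le> p then (- y) ^ k * fact (n + m - k) * of_nat (m choose k) * b (p - k)
                 else 0) =
         (\<Sum>s\<le>p. y ^ s * alt_fact_sum m n s * a (p - s))"
proof -
  have shift: "b (p - k) = (\<Sum>s\<le>p. if k \<le> s then y ^ (s - k) / fact (s - k) * a (p - s) else 0)"
    if "k \<le> p" for k
  proof -
    have "b (p - k) = (\<Sum>s\<in>{k..p}. y ^ (s - k) / fact (s - k) * a (p - s))"
      unfolding b
      by (rule sum.reindex_bij_witness [of _ "\<lambda>s. s - k" "\<lambda>s. s + k"])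
         (use that in \<open>auto simp: add.commute\<close>)
    also have "\<dots> = (\<Sum>s\<le>p. if k \<le> s then y ^ (s - k) / fact (s - k) * a (p - s) else 0)"
      by (rule sum.mono_neutral_cong_left) auto
    finally show ?thesis .
  qed
  have "(\<Sum>k\<le>m. if k \<le> p then (- y) ^ k * fact (n + m - k) * of_nat (m choose k) * b (p - k)
                else 0) =
        (\<Sum>k\<le>m. \<Sum>s\<le>p. y ^ s * (of_nat (m choose k) *
            (if k \<le> s then (-1) ^ k * fact (n + m - k) / fact (s - k) else 0)) * a (p - s))"
  proof (rule sum.cong [OF refl])
    fix k
    have pow: "(- y) ^ k * y ^ (s - k) = (-1) ^ k * y ^ s" if "k \<le> s" for s
      using that by (simp add: power_minus [of y] mult.assoc flip: power_add)
    have coeff_eq: "(- y) ^ k * fact (n + m - k) * of_nat (m choose k) *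
            (if k \<le> s then y ^ (s - k) / fact (s - k) * a (p - s) else 0) =
          y ^ s * (of_nat (m choose k) *
            (if k \<le> s then (-1) ^ k * fact (n + m - k) / fact (s - k) else 0)) * a (p - s)" for s
    proof (cases "k \<le> s")
      case True
      have "(- y) ^ k * fact (n + m - k) * of_nat (m choose k) *
              (y ^ (s - k) / fact (s - k) * a (p - s)) =
            ((- y) ^ k * y ^ (s - k)) * of_nat (m choose k) * fact (n + m - k) / fact (s - k)
              * a (p - s)"
        by (simp add: mult_ac)
      then show ?thesis
        using True by (simp add: pow mult_ac)
    qed simp
    show "(if k \<le> p then (- y) ^ k * fact (n + m - k) * of_nat (m choose k) * b (p - k)
                else 0) =
        (\<Sum>s\<le>p. y ^ s * (of_nat (m choose k) *
            (if k \<le> s then (-1) ^ k * fact (n + m - k) / fact (s - k) else 0)) * a (p - s))"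
    proof (cases "k \<le> p")
      case True
      then show ?thesis
        by (simp only: shift sum_distrib_left coeff_eq if_True)
    qed simp
  qed
  also have "\<dots> = (\<Sum>s\<le>p. y ^ s * alt_fact_sum m n s * a (p - s))"
    unfolding alt_fact_sum_def sum_distrib_left sum_distrib_right by (rule sum.swap)
  finally show ?thesis .
qed

section \<open>Comparison of coefficients\<close>

theorem theorem1:
  fixes \<alpha> l x y :: complex
    and \<Lambda> :: "nat \<Rightarrow> complex \<Rightarrow> complex"
    and m n p :: nat
  assumes "apostol_bernoulli \<alpha> l \<Lambda> \<or> apostol_euler \<alpha> l \<Lambda> \<or> apostol_genocchi \<alpha> l \<Lambda>"
  shows
    "(p \<le> m + n \<longrightarrow>
       (\<Sum>k=0..n. if k \<le> p
          then fact (n + m - k) / fact (p - k) * of_nat (n choose k) * y ^ k * \<Lambda> (p - k) x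
          else 0) =
       (\<Sum>k=0..m. if k \<le> p
          then (- y) ^ k * (fact (n + m - k) / fact (p - k)) * of_nat (m choose k)
            * \<Lambda> (p - k) (x + y)
          else 0)) \<and>
     (p \<ge> m + n + 1 \<longrightarrow>
       (\<Sum>k=0..n. if k \<le> p
          then fact (n + m - k) / fact (p - k) * of_nat (n choose k) * y ^ k * \<Lambda> (p - k) x
          else 0) =
       (\<Sum>k=0..m. if k \<le> p
          then (- y) ^ k * (fact (n + m - k) / fact (p - k)) * of_nat (m choose k)
            * \<Lambda> (p - k) (x + y)
          else 0)
       - (- 1) ^ m * (fact n * fact m / fact p) *
         (\<Sum>k=0..p - m - n - 1.
            y ^ (p - k) * of_nat (p choose k) * of_nat ((p - k - n - 1) choose m) * \<Lambda> k x))"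
proof -
  have "\<exists>g. generated_by g \<alpha> \<Lambda>"
    using assms unfolding apostol_bernoulli_def apostol_euler_def apostol_genocchi_def by blast
  then have add: "\<Lambda> q (x + y) / fact q = (\<Sum>s\<le>q. y ^ s / fact s * (\<Lambda> (q - s) x / fact (q - s)))"
    for q
    using generated_by_add by blast
  define a where "a = (\<lambda>k. \<Lambda> k x / fact k)"
  define L where "L = (\<Sum>k=0..n. if k \<le> p
          then fact (n + m - k) / fact (p - k) * of_nat (n choose k) * y ^ k * \<Lambda> (p - k) x
          else 0)"
  define R where "R = (\<Sum>k=0..m. if k \<le> p
          then (- y) ^ k * (fact (n + m - k) / fact (p - k)) * of_nat (m choose k)
            * \<Lambda> (p - k) (x + y)
          else 0)"
  define c where "c = (\<lambda>s. y ^ s * alt_fact_sum m n s * a (p - s))"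
  have "R = (\<Sum>k\<le>m. if k \<le> p then (- y) ^ k * fact (n + m - k) * of_nat (m choose k)
                      * (\<Lambda> (p - k) (x + y) / fact (p - k)) else 0)"
    unfolding R_def atLeast0AtMost by (intro sum.cong) auto
  also have "\<dots> = sum c {..p}"
    unfolding c_def
    by (rule alternating_sum_expand [where b = "\<lambda>q. \<Lambda> q (x + y) / fact q"]) (simp add: add a_def)
  finally have R: "R = sum c {..p}" .
  have "L = sum c ({..p} \<inter> {..n})"
    unfolding L_def atLeast0AtMost
    by (rule sum.mono_neutral_cong_right)
       (auto simp: c_def a_def alt_fact_sum_eq_binomial)
  \<comment> \<open>for \<open>n < s \<le> m + n\<close> the coefficient contains the factor \<open>n choose s = 0\<close>\<close>
  also have "\<dots> = sum c ({..p} \<inter> {..m + n})"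
    by (rule sum.mono_neutral_left) (auto simp: c_def alt_fact_sum_eq_binomial)
  finally have L: "L = sum c ({..p} \<inter> {..m + n})" .
  have "L = R" if "p \<le> m + n"
  proof -
    from that have "{..p} \<inter> {..m + n} = {..p}" by auto
    then show ?thesis by (simp add: L R)
  qed
  moreover have "L = R - (- 1) ^ m * (fact n * fact m / fact p) *
         (\<Sum>k=0..p - m - n - 1.
            y ^ (p - k) * of_nat (p choose k) * of_nat ((p - k - n - 1) choose m) * \<Lambda> k x)"
    if p: "p \<ge> m + n + 1"
  proof -
    have corr: "c (p - k) = (- 1) ^ m * (fact n * fact m / fact p) *
        (y ^ (p - k) * of_nat (p choose k) * of_nat ((p - k - n - 1) choose m) * \<Lambda> k x)"
      if "k \<le> p - m - n - 1" for k
    proof -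
      have k: "k \<le> p" "m + n + 1 \<le> p - k"
        using that p by auto
      show ?thesis
        using k(1) by (simp add: c_def a_def alt_fact_sum_eq_correction [OF k(2)] binomial_fact mult_ac)
    qed
    have "R - L = sum c {m + n + 1..p}"
    proof -
      have "{..p} = ({..p} \<inter> {..m + n}) \<union> {m + n + 1..p}"
        by auto
      then have "R = sum c (({..p} \<inter> {..m + n}) \<union> {m + n + 1..p})"
        unfolding R by (rule arg_cong)
      also have "\<dots> = L + sum c {m + n + 1..p}"
        unfolding L by (rule sum.union_disjoint) auto
      finally show ?thesis by simp
    qed
    also have "\<dots> = (\<Sum>k=0..p - m - n - 1. c (p - k))"
      by (rule sum.reindex_bij_witness [of _ "\<lambda>k. p - k" "\<lambda>s. p - s"]) (use p in auto)
    also have "\<dots> = (- 1) ^ m * (fact n * fact m / fact p) *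
         (\<Sum>k=0..p - m - n - 1.
            y ^ (p - k) * of_nat (p choose k) * of_nat ((p - k - n - 1) choose m) * \<Lambda> k x)"
      unfolding sum_distrib_left by (rule sum.cong [OF refl], rule corr) simp
    finally show ?thesis by (simp add: algebra_simps)
  qed
  ultimately show ?thesis
    unfolding L_def R_def by blast
qed

end
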